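(* Let $z$ be an implicit extreme point of a nonempty polyhedral convex set $C$ in $\mathbb{R}^n$ and let $\sigma=(z+\operatorname{lin}C)+N_C(z)$ (a cell of the normal manifold of $C$). Then for an $\mathrm{AVI}(C,q,M)$ with $M\in\mathbb{R}^{n\times n}$ invertible on the lineality space of $C$ and $q\in\mathbb{R}^n$, one has $\dim(M_C(\sigma))=n$.
   Context: $\mathrm{AVI}(C,q,M)$: find $z\in C$ with $\langle Mz+q,y-z\rangle\ge0$ for all $y\in C$. $\operatorname{lin}C$ is the lineality space; $N_C(z)=\{y:\langle y,z'-z\rangle\le0\ \forall z'\in C\}$. The normal map is $M_C(x)=M\pi_C(x)+q+x-\pi_C(x)$, $\pi_C$ the Euclidean projection onto $C$; $M_C(\sigma)$ is the image of $\sigma$ and its dimension is that of its affine hull. A point $z\in C$ is an implicit extreme point of $C$ if $z=\lambda z^1+(1-\lambda)z^2$ with $z^1,z^2\in C$, $\lambda\in(0,1)$ implies $z-z^1,z-z^2\in\operatorname{lin}C$. "$M$ is invertible on the lineality space of $C$" means $Q^TMQ$ is invertible, where the columns of $Q$ are an orthonormal basis of $\operatorname{lin}C$ (vacuous if $\operatorname{lin}C=\{0\}$). *)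

theory Defs
  imports "HOL-Analysis.Analysis" "Jordan_Normal_Form.Matrix"
begin

no_notation Matrix.scalar_prod (infix \<open>\<bullet>\<close> 70)
no_notation Matrix.vec_index (infixl \<open>$\<close> 100)
hide_type (open) Matrix.vec Matrix.mat
hide_const (open) Matrix.vec Matrix.mat Matrix.orthogonal

definition recession_cone :: "'a::real_vector set \<Rightarrow> 'a set" where
  "recession_cone C = {d. \<forall>x\<in>C. \<forall>t\<ge>0. x + t *\<^sub>R d \<in> C}"

definition lineality_space :: "'a::real_vector set \<Rightarrow> 'a set" where
  "lineality_space C = recession_cone C \<inter> uminus ` recession_cone C"

definition normal_cone :: "'a::real_inner set \<Rightarrow> 'a \<Rightarrow> 'a set" where
  "normal_cone C z = {y. \<forall>z'\<in>C. y \<bullet> (z' - z) \<le> 0}"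

(* closest_point C is the Euclidean projection onto C when C is closed, convex and nonempty. *)
definition normal_map :: "real^'n^'n \<Rightarrow> real^'n \<Rightarrow> (real^'n) set \<Rightarrow> real^'n \<Rightarrow> real^'n" where
  "normal_map M q C x = M *v closest_point C x + q + x - closest_point C x"

definition implicit_extreme_point :: "'a::real_vector \<Rightarrow> 'a set \<Rightarrow> bool" where
  "implicit_extreme_point z C \<longleftrightarrow>
     z \<in> C \<and>
     (\<forall>z1\<in>C. \<forall>z2\<in>C. \<forall>l::real. 0 < l \<and> l < 1 \<and> z = l *\<^sub>R z1 + (1 - l) *\<^sub>R z2 \<longrightarrow>
        z - z1 \<in> lineality_space C \<and> z - z2 \<in> lineality_space C)"

definition orthonormal_basis :: "'a::real_inner list \<Rightarrow> 'a set \<Rightarrow> bool" where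
  "orthonormal_basis qs S \<longleftrightarrow>
     distinct qs \<and> pairwise orthogonal (set qs) \<and> (\<forall>v\<in>set qs. norm v = 1) \<and> span (set qs) = S"

(* The product of the transpose of Q with M and Q, where Q has the columns qs: its (i, j) entry is
   the inner product of the i-th column with M times the j-th column.  The size of this matrix
   varies with qs and may be 0, hence the matrix type with explicit dimensions, in which the
   0 x 0 matrix is invertible. *)
definition compression :: "real^'n^'n \<Rightarrow> (real^'n) list \<Rightarrow> real Matrix.mat" where
  "compression M qs =
     Matrix.mat (length qs) (length qs) (\<lambda>(i, j). (qs ! i) \<bullet> (M *v (qs ! j)))"

(* Two orthonormal bases give orthogonally similar compressions, so the choice of qs is
   immaterial; an orthonormal basis of a subspace always exists. *)
definition invertible_on :: "real^'n^'n \<Rightarrow> (real^'n) set \<Rightarrow> bool" where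
  "invertible_on M S \<longleftrightarrow> (\<exists>qs. orthonormal_basis qs S \<and> invertible_mat (compression M qs))"

(* The cell (z + lin C) + N_C(z) of the normal manifold of C. *)
definition normal_cell :: "'a::real_inner set \<Rightarrow> 'a \<Rightarrow> 'a set" where
  "normal_cell C z = {z + l + y | l y. l \<in> lineality_space C \<and> y \<in> normal_cone C z}"

end

theory Submission
  imports Defs
begin

text \<open>
  On the cell, the projection of \<open>z + l + y\<close> is \<open>z + l\<close>, so the image of the cell is
  \<open>M z + q + M (lin C) + N_C(z)\<close>. If it lay in a hyperplane with normal \<open>a\<close>, then \<open>a\<close> would be
  orthogonal to \<open>N_C(z)\<close>, hence to all constraint normals active at \<open>z\<close>, so that \<open>z\<close> could be moved
  a little within \<open>C\<close> in both directions \<open>a\<close> and \<open>- a\<close>; implicit extremality then puts \<open>a\<close> into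
  \<open>lin C\<close>. But \<open>a\<close> is also orthogonal to \<open>M (lin C)\<close>, and invertibility on \<open>lin C\<close> forces \<open>a = 0\<close>.
\<close>

text \<open>One quantifier over all real \<open>t\<close> covers both cones: nonnegative
  \<open>t\<close> uses \<open>d\<close> as a recession direction, negative \<open>t\<close> uses
  \<open>- d\<close>.\<close>

lemma lineality_space_iff:
  "d \<in> lineality_space C \<longleftrightarrow> (\<forall>x\<in>C. \<forall>t. x + t *\<^sub>R d \<in> C)"
proof
  assume d: "d \<in> lineality_space C"
  show "\<forall>x\<in>C. \<forall>t. x + t *\<^sub>R d \<in> C"
  proof (intro ballI allI)
    fix x t assume x: "x \<in> C"
    from d have pos: "d \<in> recession_cone C" and neg: "- d \<in> recession_cone C"
      by (auto simp: lineality_space_def)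
    show "x + t *\<^sub>R d \<in> C"
    proof (cases "t \<ge> 0")
      case True
      then show ?thesis using pos x by (auto simp: recession_cone_def)
    next
      case False
      then have "x + (- t) *\<^sub>R (- d) \<in> C"
        using neg x by (auto simp: recession_cone_def simp del: scaleR_minus_left scaleR_minus_right)
      then show ?thesis by simp
    qed
  qed
next
  assume r: "\<forall>x\<in>C. \<forall>t. x + t *\<^sub>R d \<in> C"
  then have "x + t *\<^sub>R (- d) \<in> C" if "x \<in> C" for x t
    using that by (metis scaleR_minus_left scaleR_minus_right)
  with r have "d \<in> recession_cone C" "- d \<in> recession_cone C"
    by (auto simp: recession_cone_def simp del: scaleR_minus_right)
  then show "d \<in> lineality_space C"
    unfolding lineality_space_def by (metis IntI image_eqI minus_minus)
qed

lemma zero_in_lineality_space: "0 \<in> lineality_space C"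
  by (simp add: lineality_space_iff)

lemma lineality_space_scaleR:
  assumes "d \<in> lineality_space C"
  shows "c *\<^sub>R d \<in> lineality_space C"
  using assms by (simp add: lineality_space_iff)

lemma zero_in_normal_cone: "0 \<in> normal_cone C z"
  by (simp add: normal_cone_def)

text \<open>The whole line through \<open>z\<close> in direction \<open>l\<close> lies in
  \<open>C\<close>. A linear functional bounded above on a line is constant along it; the points
  \<open>z + l\<close> and \<open>z - l\<close> suffice.\<close>

lemma normal_cone_orthogonal_lineality_space:
  assumes "z \<in> C" "l \<in> lineality_space C" "y \<in> normal_cone C z"
  shows "y \<bullet> l = 0"
proof -
  have "z + 1 *\<^sub>R l \<in> C" "z + (- 1) *\<^sub>R l \<in> C"
    using assms(1,2) unfolding lineality_space_iff by blast+
  with assms(3) have "y \<bullet> (z + 1 *\<^sub>R l - z) \<le> 0" "y \<bullet> (z + (- 1) *\<^sub>R l - z) \<le> 0"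
    unfolding normal_cone_def by blast+
  then show ?thesis by simp
qed

lemma normal_cone_translate_lineality_space:
  assumes "z \<in> C" "l \<in> lineality_space C" "y \<in> normal_cone C z"
  shows "y \<in> normal_cone C (z + l)"
  using assms normal_cone_orthogonal_lineality_space[OF assms]
  by (simp add: normal_cone_def inner_diff_right inner_add_right)

text \<open>Expanding the squared distance from \<open>p + y\<close> to \<open>w\<close> leaves a
  cross term whose sign is given by the normal cone inequality.\<close>

lemma closest_point_add_normal:
  fixes C :: "'a::euclidean_space set"
  assumes "convex C" "closed C" "p \<in> C" "y \<in> normal_cone C p"
  shows "closest_point C (p + y) = p"
proof -
  have "dist (p + y) p \<le> dist (p + y) w" if "w \<in> C" for w
  proof -
    have "y \<bullet> (w - p) \<le> 0" using assms(4) that by (simp add: normal_cone_def)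
    moreover have "(p + y - w) \<bullet> (p + y - w)
        = y \<bullet> y - 2 * (y \<bullet> (w - p)) + (w - p) \<bullet> (w - p)"
      by (simp add: algebra_simps inner_commute)
    ultimately have "y \<bullet> y \<le> (p + y - w) \<bullet> (p + y - w)"
      using inner_ge_zero[of "w - p"] by linarith
    then show ?thesis by (simp add: dist_norm norm_le)
  qed
  then show ?thesis
    using closest_point_unique[OF assms(1-3)] by metis
qed

lemma normal_map_on_normal_cell:
  assumes "convex C" "closed C" "z \<in> C" "l \<in> lineality_space C" "y \<in> normal_cone C z"
  shows "normal_map M q C (z + l + y) = M *v (z + l) + q + y"
proof -
  have "z + 1 *\<^sub>R l \<in> C" using assms(3,4) unfolding lineality_space_iff by blast
  then have "closest_point C (z + l + y) = z + l"
    using closest_point_add_normal[OF assms(1,2)] normal_cone_translate_lineality_space[OF assms(3-5)]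
    by simp
  then show ?thesis by (simp add: normal_map_def)
qed

text \<open>Treats the finitely many half-spaces one at a time. The neighbourhood of 0 makes
  \<open>w\<close> and \<open>- w\<close> feasible at once.\<close>

lemma polyhedron_feasible_direction:
  fixes C :: "'a::euclidean_space set"
  assumes "polyhedron C" "z \<in> C" and orth: "\<And>y. y \<in> normal_cone C z \<Longrightarrow> y \<bullet> w = 0"
  shows "\<forall>\<^sub>F t in nhds (0::real). z + t *\<^sub>R w \<in> C"
proof -
  obtain F where F: "finite F" "C = \<Inter>F"
    and half: "\<And>h. h \<in> F \<Longrightarrow> \<exists>a b. a \<noteq> 0 \<and> h = {x. a \<bullet> x \<le> b}"
    using assms(1) unfolding polyhedron_def by metis
  have "\<forall>\<^sub>F t in nhds (0::real). z + t *\<^sub>R w \<in> h" if "h \<in> F" for h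
  proof -
    obtain a b where h: "h = {x. a \<bullet> x \<le> b}" using half[OF \<open>h \<in> F\<close>] by blast
    have sub: "C \<subseteq> h" using F that by blast
    show ?thesis
    proof (cases "a \<bullet> z = b")
      \<comment> \<open>Active constraint: \<open>a\<close> is itself a normal vector at
        \<open>z\<close>, so moving along \<open>w\<close> leaves \<open>a \<bullet> x\<close>
        unchanged.\<close>
      case True
      then have "a \<in> normal_cone C z"
        using sub h by (auto simp: normal_cone_def inner_diff_right)
      then show ?thesis using orth True h by (simp add: inner_add_right)
    next
      \<comment> \<open>Inactive constraint: the slack at \<open>z\<close> survives small moves by
        continuity.\<close>
      case False
      then have "a \<bullet> z < b" using sub h assms(2) by force
      moreover have "((\<lambda>t. a \<bullet> (z + t *\<^sub>R w)) \<longlongrightarrow> a \<bullet> (z + 0 *\<^sub>R w)) (nhds 0)"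
        by (intro tendsto_intros filterlim_ident)
      ultimately have "\<forall>\<^sub>F t in nhds 0. a \<bullet> (z + t *\<^sub>R w) < b"
        by (intro order_tendstoD) auto
      then show ?thesis by eventually_elim (simp add: h)
    qed
  qed
  then have "\<forall>\<^sub>F t in nhds (0::real). \<forall>h\<in>F. z + t *\<^sub>R w \<in> h"
    using F(1) by (simp add: eventually_ball_finite)
  then show ?thesis by (simp add: F(2))
qed

lemma orthogonal_normal_cone_imp_lineality_space:
  fixes C :: "'a::euclidean_space set"
  assumes "polyhedron C" "implicit_extreme_point z C"
    and "\<And>y. y \<in> normal_cone C z \<Longrightarrow> y \<bullet> w = 0"
  shows "w \<in> lineality_space C"
proof -
  have "z \<in> C" using assms(2) by (simp add: implicit_extreme_point_def)
  then obtain d where d: "d > 0" "\<And>t. dist t 0 < d \<Longrightarrow> z + t *\<^sub>R w \<in> C"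
    using polyhedron_feasible_direction[OF assms(1) _ assms(3)]
    unfolding eventually_nhds_metric by metis
  \<comment> \<open>Half of \<open>d\<close>, to meet the strict bound \<open>dist t 0 < d\<close>.
    Then \<open>z\<close> is the midpoint of two points of \<open>C\<close>.\<close>
  define e where "e = d / 2"
  have "e > 0" using d(1) by (simp add: e_def)
  have "z + e *\<^sub>R w \<in> C" "z + (- e) *\<^sub>R w \<in> C"
    using d by (auto simp: e_def simp del: scaleR_minus_left)
  moreover have "z = (1/2) *\<^sub>R (z + e *\<^sub>R w) + (1 - 1/2) *\<^sub>R (z + (- e) *\<^sub>R w)"
    by (simp add: scaleR_add_right scaleR_diff_right flip: scaleR_add_left)
  moreover have "0 < (1/2::real)" "(1/2::real) < 1" by simp_all
  ultimately have "z - (z + e *\<^sub>R w) \<in> lineality_space C"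
    using assms(2) unfolding implicit_extreme_point_def
    by blast
  \<comment> \<open>The difference is \<open>- e *\<^sub>R w\<close>; this factor rescales it to
    \<open>w\<close>.\<close>
  then have "(- 1 / e) *\<^sub>R (z - (z + e *\<^sub>R w)) \<in> lineality_space C"
    by (rule lineality_space_scaleR)
  then show ?thesis using \<open>e > 0\<close> by simp
qed

text \<open>The coefficients of \<open>w\<close> in the basis form a row vector annihilated by the
  compression from the left, and a right inverse forces this vector to vanish.\<close>

lemma invertible_on_nondegenerate:
  fixes M :: "real^'n^'n"
  assumes "invertible_on M S" "w \<in> S" and orth: "\<And>l. l \<in> S \<Longrightarrow> w \<bullet> (M *v l) = 0"
  shows "w = 0"
proof -
  obtain qs where dist: "distinct qs" and S: "span (set qs) = S"
    and inv: "invertible_mat (compression M qs)"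
    using assms(1) unfolding invertible_on_def orthonormal_basis_def by blast
  define n where "n = length qs"
  define A where "A i j = (qs ! i) \<bullet> (M *v (qs ! j))" for i j
  have A: "compression M qs = Matrix.mat n n (\<lambda>(i, j). A i j)"
    by (simp add: compression_def n_def A_def)
  obtain B where AB: "compression M qs * B = 1\<^sub>m n" and BA: "B * compression M qs = 1\<^sub>m (dim_row B)"
    using inv by (auto simp: invertible_mat_def inverts_mat_def A)
  \<comment> \<open>\<open>invertible_mat\<close> does not state the shape of \<open>B\<close>;
    comparing column counts in the two identities recovers it.\<close>
  have dims: "dim_col B = n" "dim_row B = n"
    using arg_cong[OF AB, of dim_col] arg_cong[OF BA, of dim_col] by (simp_all add: A)
  obtain u where "w = (\<Sum>v\<in>set qs. u v *\<^sub>R v)"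
    using assms(2) S span_finite[of "set qs"] by auto
  also have "\<dots> = (\<Sum>i<n. u (qs ! i) *\<^sub>R (qs ! i))"
    using sum.reindex_bij_betw[OF bij_betw_nth[OF dist, of "{..<n}" "set qs"], of "\<lambda>v. u v *\<^sub>R v"]
    by (simp add: n_def)
  finally have w: "w = (\<Sum>i<n. u (qs ! i) *\<^sub>R (qs ! i))" .
  have uA: "(\<Sum>i<n. u (qs ! i) * A i j) = 0" if "j < n" for j
  proof -
    have "qs ! j \<in> S" using that S span_base[of "qs ! j" "set qs"] by (simp add: n_def)
    then have "w \<bullet> (M *v (qs ! j)) = 0" by (rule orth)
    then show ?thesis by (subst (asm) w) (simp add: inner_sum_left A_def)
  qed
  have "u (qs ! k) = 0" if k: "k < n" for k
  proof -
    have ABik: "(\<Sum>j<n. A i j * B $$ (j, k)) = (if i = k then 1 else 0)" if "i < n" for i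
    proof -
      have "(compression M qs * B) $$ (i, k) = (\<Sum>j<n. A i j * B $$ (j, k))"
        using that k dims by (simp add: A scalar_prod_def atLeast0LessThan)
      then show ?thesis using AB that k by simp
    qed
    \<comment> \<open>Associativity of the product u A B, entry \<open>k\<close>: u (A B) gives
      \<open>u (qs ! k)\<close>, while (u A) B is 0 by \<open>uA\<close>.\<close>
    have "u (qs ! k) = (\<Sum>i<n. u (qs ! i) * (if i = k then 1 else 0))"
      using k by (simp add: mult_delta_right)
    also have "\<dots> = (\<Sum>i<n. u (qs ! i) * (\<Sum>j<n. A i j * B $$ (j, k)))"
      by (intro sum.cong) (simp_all add: ABik)
    also have "\<dots> = (\<Sum>j<n. (\<Sum>i<n. u (qs ! i) * A i j) * B $$ (j, k))"
      by (simp add: sum_distrib_left sum_distrib_right mult.assoc) (rule sum.swap)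
    also have "\<dots> = 0" by (simp add: uA)
    finally show ?thesis .
  qed
  then show ?thesis by (subst w) simp
qed

theorem proposition3p4:
  fixes C :: "(real^'n) set" and z q :: "real^'n" and M :: "real^'n^'n"
  assumes "polyhedron C" and "C \<noteq> {}"
    and "implicit_extreme_point z C"
    and "invertible_on M (lineality_space C)"
  shows "aff_dim (normal_map M q C ` normal_cell C z) = int CARD('n)"
proof (rule ccontr)
  let ?S = "normal_map M q C ` normal_cell C z"
  assume "aff_dim ?S \<noteq> int CARD('n)"
  then have "aff_dim ?S < int DIM(real^'n)"
    using aff_dim_le_DIM[of ?S] by simp
  then obtain a b where "a \<noteq> 0" and hyp: "?S \<subseteq> {x. a \<bullet> x = b}"
    by (rule aff_lowdim_subset_hyperplane)
  have z: "z \<in> C" using assms(3) by (simp add: implicit_extreme_point_def)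
  have eq: "a \<bullet> (M *v (z + l) + q + y) = b"
    if "l \<in> lineality_space C" "y \<in> normal_cone C z" for l y
  proof -
    have "z + l + y \<in> normal_cell C z" using that by (auto simp: normal_cell_def)
    then have "a \<bullet> normal_map M q C (z + l + y) = b" using hyp by blast
    then show ?thesis
      using normal_map_on_normal_cell[OF polyhedron_imp_convex[OF assms(1)]
          polyhedron_imp_closed[OF assms(1)] z that] by simp
  qed
  \<comment> \<open>The value at \<open>l = 0\<close>, \<open>y = 0\<close>. Subtracting it from
    \<open>eq\<close> with only one of \<open>l\<close>, \<open>y\<close> set to 0 isolates
    \<open>a \<bullet> y\<close> or \<open>a \<bullet> (M *v l)\<close>.\<close>
  note base = eq[OF zero_in_lineality_space zero_in_normal_cone]
  have "y \<bullet> a = 0" if "y \<in> normal_cone C z" for y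
    using eq[OF zero_in_lineality_space that] base by (simp add: inner_add_right inner_commute)
  then have "a \<in> lineality_space C"
    by (rule orthogonal_normal_cone_imp_lineality_space[OF assms(1,3)])
  moreover have "a \<bullet> (M *v l) = 0" if "l \<in> lineality_space C" for l
    using eq[OF that zero_in_normal_cone] base
    by (simp add: inner_add_right matrix_vector_right_distrib)
  ultimately have "a = 0" by (rule invertible_on_nondegenerate[OF assms(4)])
  with \<open>a \<noteq> 0\<close> show False by simp
qed

end
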